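(* The following hold for topological spaces. (1) Every $\sigma$-compact locally compact space is a $k_\omega$-space, and every locally compact space is a $k$-space. (2) Every quotient of a $k_\omega$-space is a $k_\omega$-space, and every quotient of a $k$-space is a $k$-space. (3) Every $k_\omega$-space is a quotient of a $\sigma$-compact locally compact space, and every $k$-space is a quotient of a paracompact locally compact space.
   Context: No separation axiom is assumed: compact, locally compact, paracompact, $k$-space and $k_\omega$-space do not include Hausdorffness. A space is locally compact if every point admits a compact neighborhood. A space is $\sigma$-compact if it is a countable union of compact subsets. A space is paracompact if every open cover has a locally finite open refinement. A quotient of $E$ is a space $\tilde E$ for which there is a quotient map $\pi:E\to\tilde E$ (a surjection such that $C\subset\tilde E$ is closed if and only if $\pi^{-1}(C)$ is closed). A topological space $E$ is a $k$-space if every subset $O\subset E$ is open if and only if, for every compact set $K\subset E$, $O\cap K$ is open in $K$ (induced topology). A topological space $E$ is a $k_\omega$-space if there is a countable sequence $K_i$, $i\ge 1$, of compact subsets with $\bigcup_{i=1}^\infty K_i=E$ such that every subset $O\subset E$ is open if and only if $O\cap K_i$ is open in $K_i$ for every $i$. *)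

theory Defs
  imports "HOL-Analysis.Analysis"
begin

text \<open>
  Spaces are values of type \<^typ>\<open>'a topology\<close>. The library notions \<^const>\<open>compactin\<close>,
  \<^const>\<open>locally_compact_space\<close>, \<^const>\<open>k_space\<close> and \<^const>\<open>quotient_map\<close> involve no separation
  axiom. The library phrases \<^const>\<open>k_space\<close> with closed sets and \<^const>\<open>quotient_map\<close> with open
  sets; the next two lemmas give the open, respectively closed, forms.
\<close>

lemma k_space_iff_open:
  "k_space X \<longleftrightarrow>
    (\<forall>U. U \<subseteq> topspace X \<longrightarrow>
      (openin X U \<longleftrightarrow> (\<forall>K. compactin X K \<longrightarrow> openin (subtopology X K) (U \<inter> K))))"
  unfolding k_space_open by (metis Int_commute openin_subtopology_Int)

lemma quotient_map_iff_closed: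
  "quotient_map X Y f \<longleftrightarrow>
    f ` topspace X = topspace Y \<and>
    (\<forall>C. C \<subseteq> topspace Y \<longrightarrow>
      (closedin Y C \<longleftrightarrow> closedin X {x \<in> topspace X. f x \<in> C}))"
  unfolding quotient_map_closedin by auto

definition sigma_compact_space :: "'a topology \<Rightarrow> bool" where
  "sigma_compact_space X \<longleftrightarrow>
    (\<exists>K :: nat \<Rightarrow> 'a set. (\<forall>i. compactin X (K i)) \<and> (\<Union>i. K i) = topspace X)"

definition paracompact_space :: "'a topology \<Rightarrow> bool" where
  "paracompact_space X \<longleftrightarrow>
    (\<forall>\<U>. (\<forall>U\<in>\<U>. openin X U) \<and> \<Union>\<U> = topspace X \<longrightarrow>
      (\<exists>\<V>. (\<forall>V\<in>\<V>. openin X V) \<and> \<Union>\<V> = topspace X \<and>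
           (\<forall>V\<in>\<V>. \<exists>U\<in>\<U>. V \<subseteq> U) \<and> locally_finite_in X \<V>))"

definition k_omega_space :: "'a topology \<Rightarrow> bool" where
  "k_omega_space X \<longleftrightarrow>
    (\<exists>K :: nat \<Rightarrow> 'a set.
      (\<forall>i. compactin X (K i)) \<and> (\<Union>i. K i) = topspace X \<and>
      (\<forall>U. U \<subseteq> topspace X \<longrightarrow>
        (openin X U \<longleftrightarrow> (\<forall>i. openin (subtopology X (K i)) (U \<inter> K i)))))"

definition is_quotient_of :: "'b topology \<Rightarrow> 'a topology \<Rightarrow> bool" where
  "is_quotient_of Y X \<longleftrightarrow> (\<exists>f. quotient_map X Y f)"

end

theory Submission
  imports Defs
begin

text \<open>
  Both notions say that the topology of a space is determined by a family of compact subsets: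
  by all of them for a \<^const>\<open>k_space\<close>, by a suitable sequence for a \<^const>\<open>k_omega_space\<close>.

  A locally compact space is determined by any family of compact sets whose interiors cover it,
  because openness can be tested on an open cover. The compact sets that witness
  \<open>\<sigma>\<close>-compactness need not have this property (the singletons do not determine the topology of
  a convergent sequence with its limit), but each of them lies in the interior of a larger compact
  set (\<open>locally_compact_space_compact_neighbourhood\<close>), and these larger sets do.

  Quotients inherit the property because the images of a determining family determine the quotient:
  if the trace of \<open>U\<close> on the image of \<open>K\<close> is open, then so is the trace on \<open>K\<close> of the preimage
  of \<open>U\<close>.

  For the converse, a cover \<open>K\<close> of \<open>X\<close> determines the topology of \<open>X\<close> precisely when the
  canonical map from the disjoint sum of the \<open>K i\<close> to \<open>X\<close> is a quotient map
  (\<open>quotient_map_snd_sum_topology\<close>). A disjoint sum of compact spaces is locally compact and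
  paracompact, and it is \<open>\<sigma>\<close>-compact when the sum is countable.
\<close>

section \<open>Locally compact spaces\<close>

text \<open>
  The enlargement that turns a compact cover into a cover by interiors of compact sets. The
  neighbourhood is a finite union of compact neighbourhoods of points.
\<close>

lemma locally_compact_space_compact_neighbourhood:
  assumes X: "locally_compact_space X" and K: "compactin X K"
  shows "\<exists>U L. openin X U \<and> compactin X L \<and> K \<subseteq> U \<and> U \<subseteq> L"
proof -
  obtain U L where UL:
    "\<And>x. x \<in> topspace X \<Longrightarrow> openin X (U x) \<and> compactin X (L x) \<and> x \<in> U x \<and> U x \<subseteq> L x"
    using X unfolding locally_compact_space_def by metis
  have KX: "K \<subseteq> topspace X"
    using K by (rule compactin_subset_topspace)
  have "\<And>V. V \<in> U ` K \<Longrightarrow> openin X V" and "K \<subseteq> \<Union> (U ` K)"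
    using UL KX by blast+
  then obtain F where F: "finite F" "F \<subseteq> K" "K \<subseteq> \<Union> (U ` F)"
    using K by (metis compactinD finite_subset_image)
  have "openin X (\<Union> (U ` F))"
    using UL KX F(2) by blast
  moreover have "compactin X (\<Union> (L ` F))"
    using UL KX F by (intro compactin_Union) auto
  moreover have "\<Union> (U ` F) \<subseteq> \<Union> (L ` F)"
    using UL KX F(2) by blast
  ultimately show ?thesis
    using F(3) by blast
qed

text \<open>
  If the trace of \<open>U\<close> on \<open>L i\<close> is open, then so is the trace on the open set \<open>W i\<close> inside \<open>L i\<close>, and
  \<open>U\<close> is the union of the latter traces.
\<close>

lemma openin_iff_openin_traces_of_neighbourhoods:
  assumes W: "\<And>i. openin X (W i)" "\<And>i. W i \<subseteq> L i" and cover: "(\<Union>i. W i) = topspace X"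
    and U: "U \<subseteq> topspace X"
  shows "openin X U \<longleftrightarrow> (\<forall>i. openin (subtopology X (L i)) (U \<inter> L i))"
proof
  assume "openin X U"
  then show "\<forall>i. openin (subtopology X (L i)) (U \<inter> L i)"
    by (simp add: openin_subtopology_Int)
next
  assume R: "\<forall>i. openin (subtopology X (L i)) (U \<inter> L i)"
  have "openin X (U \<inter> W i)" for i
  proof -
    obtain T where T: "openin X T" "U \<inter> L i = T \<inter> L i"
      using R by (meson openin_subtopology)
    then have "U \<inter> W i = T \<inter> W i"
      using W(2)[of i] by blast
    then show ?thesis
      using T(1) W(1) by auto
  qed
  then have "openin X (\<Union>i. U \<inter> W i)"
    by blast
  moreover have "(\<Union>i. U \<inter> W i) = U"
    using U cover by blast
  ultimately show "openin X U"
    by simp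
qed

lemma sigma_compact_locally_compact_imp_k_omega_space:
  assumes "sigma_compact_space X" and X: "locally_compact_space X"
  shows "k_omega_space X"
proof -
  obtain K :: "nat \<Rightarrow> 'a set" where K: "\<And>i. compactin X (K i)" "(\<Union>i. K i) = topspace X"
    using assms(1) unfolding sigma_compact_space_def by auto
  obtain W L where WL: "\<And>i. openin X (W i)" "\<And>i. compactin X (L i)"
      "\<And>i. K i \<subseteq> W i" "\<And>i. W i \<subseteq> L i"
    using locally_compact_space_compact_neighbourhood[OF X K(1)] by metis
  have W: "(\<Union>i. W i) = topspace X"
  proof
    show "(\<Union>i. W i) \<subseteq> topspace X"
      using openin_subset[OF WL(1)] by (rule UN_least)
    show "topspace X \<subseteq> (\<Union>i. W i)"
      unfolding K(2)[symmetric] using WL(3) by (rule UN_mono[OF order_refl])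
  qed
  have L: "(\<Union>i. L i) = topspace X"
  proof
    show "(\<Union>i. L i) \<subseteq> topspace X"
      using compactin_subset_topspace[OF WL(2)] by (rule UN_least)
    show "topspace X \<subseteq> (\<Union>i. L i)"
      unfolding W[symmetric] using WL(4) by (rule UN_mono[OF order_refl])
  qed
  have "openin X U \<longleftrightarrow> (\<forall>i. openin (subtopology X (L i)) (U \<inter> L i))"
    if "U \<subseteq> topspace X" for U
    using WL(1,4) W that by (rule openin_iff_openin_traces_of_neighbourhoods)
  then show ?thesis
    unfolding k_omega_space_def using WL(2) L by (intro exI[of _ L]) simp
qed

section \<open>Quotients\<close>

text \<open>
  The restriction of \<open>f\<close> to \<open>K i\<close> is continuous onto \<open>f ` K i\<close>, so it pulls an open trace of \<open>U\<close>
  back to an open trace of the preimage of \<open>U\<close>; the preimage is then open in \<open>X\<close>, hence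
  \<open>U\<close> is open in the quotient.
\<close>

lemma k_omega_space_quotient_map_image:
  assumes f: "quotient_map X Y f" and X: "k_omega_space X"
  shows "k_omega_space Y"
proof -
  obtain K :: "nat \<Rightarrow> 'a set" where K: "\<And>i. compactin X (K i)" "(\<Union>i. K i) = topspace X"
    and det: "\<And>U. U \<subseteq> topspace X \<Longrightarrow>
      openin X U \<longleftrightarrow> (\<forall>i. openin (subtopology X (K i)) (U \<inter> K i))"
    using X unfolding k_omega_space_def by auto
  have cont: "continuous_map X Y f"
    using f by (rule quotient_imp_continuous_map)
  have "openin Y U"
    if U: "U \<subseteq> topspace Y" and R: "\<And>i. openin (subtopology Y (f ` K i)) (U \<inter> f ` K i)" for U
  proof -
    let ?P = "{x \<in> topspace X. f x \<in> U}"
    have "openin (subtopology X (K i)) (?P \<inter> K i)" for i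
    proof -
      have "continuous_map (subtopology X (K i)) (subtopology Y (f ` K i)) f"
        using cont by (auto simp: continuous_map_in_subtopology continuous_map_from_subtopology)
      then have "openin (subtopology X (K i))
          {x \<in> topspace (subtopology X (K i)). f x \<in> U \<inter> f ` K i}"
        using R by (rule openin_continuous_map_preimage)
      moreover have "{x \<in> topspace (subtopology X (K i)). f x \<in> U \<inter> f ` K i} = ?P \<inter> K i"
        by auto
      ultimately show ?thesis
        by simp
    qed
    then have "openin X ?P"
      using det[of ?P] by auto
    then show ?thesis
      using f U unfolding quotient_map_def by blast
  qed
  then have "\<forall>U. U \<subseteq> topspace Y \<longrightarrow>
      (openin Y U \<longleftrightarrow> (\<forall>i. openin (subtopology Y (f ` K i)) (U \<inter> f ` K i)))"
    by (auto simp: openin_subtopology_Int)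
  moreover have "compactin Y (f ` K i)" for i
    using K(1) cont by (rule image_compactin)
  moreover have "(\<Union>i. f ` K i) = topspace Y"
    by (simp add: image_UN[symmetric] K(2) quotient_imp_surjective_map[OF f])
  ultimately show ?thesis
    unfolding k_omega_space_def by (intro exI[of _ "\<lambda>i. f ` K i"]) simp
qed

section \<open>Disjoint sums of compact spaces\<close>

text \<open>
  The preimage of \<open>U\<close> under the canonical map has the trace of \<open>U\<close> on \<open>K i\<close> as its part in the
  summand of index \<open>i\<close>, so openness in the sum is openness of all traces.
\<close>

lemma quotient_map_snd_sum_topology:
  assumes cover: "(\<Union>i\<in>I. K i) = topspace X"
  shows "quotient_map (sum_topology (\<lambda>i. subtopology X (K i)) I) X snd \<longleftrightarrow>
    (\<forall>U. U \<subseteq> topspace X \<longrightarrow>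
      (openin X U \<longleftrightarrow> (\<forall>i\<in>I. openin (subtopology X (K i)) (U \<inter> K i))))"
proof -
  let ?S = "sum_topology (\<lambda>i. subtopology X (K i)) I"
  have surj: "snd ` topspace ?S = topspace X"
    using cover by (auto simp: snd_image_Sigma)
  have pre: "openin ?S {z \<in> topspace ?S. snd z \<in> U} \<longleftrightarrow>
      (\<forall>i\<in>I. openin (subtopology X (K i)) (U \<inter> K i))" if "U \<subseteq> topspace X" for U
  proof -
    have "{z \<in> topspace ?S. snd z \<in> U} = (SIGMA i:I. U \<inter> K i)"
      using that by auto
    then show ?thesis
      by (simp add: openin_disjoint_union)
  qed
  show ?thesis
    unfolding quotient_map_def using surj pre by auto
qed

lemma compact_imp_paracompact_space:
  assumes "compact_space X"
  shows "paracompact_space X"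
  unfolding paracompact_space_def
proof (intro allI impI)
  fix \<U> assume \<U>: "(\<forall>U\<in>\<U>. openin X U) \<and> \<Union>\<U> = topspace X"
  then obtain \<F> where \<F>: "finite \<F>" "\<F> \<subseteq> \<U>" "topspace X \<subseteq> \<Union>\<F>"
    using assms unfolding compact_space_def compactin_def by (metis order_refl)
  then have "\<Union>\<F> = topspace X"
    using \<U> by blast
  moreover from this have "locally_finite_in X \<F>"
    using \<F>(1) by (simp add: finite_imp_locally_finite_in)
  moreover have "\<forall>V\<in>\<F>. openin X V"
    using \<U> \<F>(2) by auto
  moreover have "\<forall>V\<in>\<F>. \<exists>U\<in>\<U>. V \<subseteq> U"
    using \<F>(2) by (meson order_refl subsetD)
  ultimately show "\<exists>\<V>. (\<forall>V\<in>\<V>. openin X V) \<and> \<Union>\<V> = topspace X \<and>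
      (\<forall>V\<in>\<V>. \<exists>U\<in>\<U>. V \<subseteq> U) \<and> locally_finite_in X \<V>"
    by (intro exI[of _ \<F>] conjI)
qed

text \<open>
  Refine the cover on each summand separately. Local finiteness survives since a neighbourhood
  inside one summand meets only the sets that come from that summand.
\<close>

lemma paracompact_space_sum_topology:
  assumes X: "\<And>i. i \<in> I \<Longrightarrow> paracompact_space (X i)"
  shows "paracompact_space (sum_topology X I)"
  unfolding paracompact_space_def
proof (intro allI impI)
  let ?S = "sum_topology X I"
  fix \<U> assume \<U>: "(\<forall>U\<in>\<U>. openin ?S U) \<and> \<Union>\<U> = topspace ?S"
  define slices where "slices i = (\<lambda>U. Pair i -` U) ` \<U>" for i
  have "\<exists>\<V>. (\<forall>V\<in>\<V>. openin (X i) V) \<and> \<Union>\<V> = topspace (X i) \<and>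
      (\<forall>V\<in>\<V>. \<exists>U\<in>slices i. V \<subseteq> U) \<and> locally_finite_in (X i) \<V>" if i: "i \<in> I" for i
  proof -
    have "\<forall>U\<in>slices i. openin (X i) U"
      using \<U> i by (auto simp: slices_def openin_sum_topology vimage_def)
    moreover have "\<Union>(slices i) = topspace (X i)"
    proof -
      have "\<Union>(slices i) = Pair i -` \<Union>\<U>"
        by (auto simp: slices_def)
      then show ?thesis
        using \<U> i by auto
    qed
    ultimately show ?thesis
      by (intro X[OF i, unfolded paracompact_space_def, THEN spec, THEN mp] conjI)
  qed
  then obtain \<V> where
    op: "\<And>i V. \<lbrakk>i \<in> I; V \<in> \<V> i\<rbrakk> \<Longrightarrow> openin (X i) V" and
    cov: "\<And>i. i \<in> I \<Longrightarrow> \<Union>(\<V> i) = topspace (X i)" and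
    ref: "\<And>i V. \<lbrakk>i \<in> I; V \<in> \<V> i\<rbrakk> \<Longrightarrow> \<exists>U\<in>slices i. V \<subseteq> U" and
    fin: "\<And>i. i \<in> I \<Longrightarrow> locally_finite_in (X i) (\<V> i)"
    by metis
  define \<W> where "\<W> = (\<Union>i\<in>I. (\<lambda>V. Pair i ` V) ` \<V> i)"
  have "\<forall>W\<in>\<W>. openin ?S W"
    using op open_map_component_injection[of _ I X] by (auto simp: \<W>_def open_map_def)
  moreover have cover: "\<Union>\<W> = topspace ?S"
  proof -
    have "\<Union>\<W> = (SIGMA i:I. \<Union>(\<V> i))"
      by (auto simp: \<W>_def)
    also have "\<dots> = topspace ?S"
      unfolding topspace_sum_topology by (intro Sigma_cong refl) (simp add: cov)
    finally show ?thesis .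
  qed
  moreover have "\<forall>W\<in>\<W>. \<exists>U\<in>\<U>. W \<subseteq> U"
  proof
    fix W assume "W \<in> \<W>"
    then obtain i V where iV: "i \<in> I" "V \<in> \<V> i" "W = Pair i ` V"
      by (auto simp: \<W>_def)
    obtain U where "U \<in> \<U>" "V \<subseteq> Pair i -` U"
      using ref[OF iV(1,2)] by (auto simp: slices_def)
    then show "\<exists>U\<in>\<U>. W \<subseteq> U"
      using iV(3) by blast
  qed
  moreover have "locally_finite_in ?S \<W>"
    unfolding locally_finite_in_def
  proof (intro conjI ballI)
    show "\<Union>\<W> \<subseteq> topspace ?S"
      using cover by simp
  next
    fix z assume "z \<in> topspace ?S"
    then obtain i x where z: "z = (i, x)" "i \<in> I" "x \<in> topspace (X i)"
      by auto
    obtain N where N: "openin (X i) N" "x \<in> N" "finite {V \<in> \<V> i. V \<inter> N \<noteq> {}}"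
      using fin[OF z(2)] z(3) unfolding locally_finite_in_def by blast
    have "openin ?S (Pair i ` N)"
      using N(1) open_map_component_injection[OF z(2), of X] by (auto simp: open_map_def)
    moreover have "{W \<in> \<W>. W \<inter> Pair i ` N \<noteq> {}} \<subseteq> (\<lambda>V. Pair i ` V) ` {V \<in> \<V> i. V \<inter> N \<noteq> {}}"
      by (auto simp: \<W>_def)
    then have "finite {W \<in> \<W>. W \<inter> Pair i ` N \<noteq> {}}"
      using N(3) finite_surj by blast
    ultimately show "\<exists>N. openin ?S N \<and> z \<in> N \<and> finite {W \<in> \<W>. W \<inter> N \<noteq> {}}"
      using z(1) N(2) by blast
  qed
  ultimately show "\<exists>\<V>. (\<forall>V\<in>\<V>. openin ?S V) \<and> \<Union>\<V> = topspace ?S \<and>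
      (\<forall>V\<in>\<V>. \<exists>U\<in>\<U>. V \<subseteq> U) \<and> locally_finite_in ?S \<V>"
    by (intro exI[of _ \<W>] conjI)
qed

lemma sigma_compact_space_sum_topology:
  fixes X :: "nat \<Rightarrow> 'a topology"
  assumes "\<And>i. compact_space (X i)"
  shows "sigma_compact_space (sum_topology X UNIV)"
  unfolding sigma_compact_space_def
proof (intro exI conjI allI)
  show "compactin (sum_topology X UNIV) (Pair i ` topspace (X i))" for i
    using assms[of i] continuous_map_component_injection[of i UNIV X]
    by (simp add: compact_space_def image_compactin)
  show "(\<Union>i. Pair i ` topspace (X i)) = topspace (sum_topology X UNIV)"
    by auto
qed

lemma k_omega_space_imp_quotient:
  fixes X :: "'a topology"
  assumes "k_omega_space X"
  shows "\<exists>Z :: (nat \<times> 'a) topology.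
    sigma_compact_space Z \<and> locally_compact_space Z \<and> is_quotient_of X Z"
proof -
  obtain K :: "nat \<Rightarrow> 'a set" where K: "\<And>i. compactin X (K i)" "(\<Union>i. K i) = topspace X"
    and det: "\<forall>U. U \<subseteq> topspace X \<longrightarrow>
      (openin X U \<longleftrightarrow> (\<forall>i. openin (subtopology X (K i)) (U \<inter> K i)))"
    using assms unfolding k_omega_space_def by auto
  let ?Z = "sum_topology (\<lambda>i. subtopology X (K i)) UNIV"
  have "sigma_compact_space ?Z" "locally_compact_space ?Z"
    using K(1) by (simp_all add: sigma_compact_space_sum_topology compact_space_subtopology
        locally_compact_space_sum_topology compact_imp_locally_compact_space)
  moreover have "quotient_map ?Z X snd"
    using quotient_map_snd_sum_topology[of K UNIV X] K(2) det by simp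
  ultimately show ?thesis
    unfolding is_quotient_of_def by blast
qed

lemma k_space_imp_quotient:
  fixes X :: "'a topology"
  assumes "k_space X"
  shows "\<exists>Z :: ('a set \<times> 'a) topology.
    paracompact_space Z \<and> locally_compact_space Z \<and> is_quotient_of X Z"
proof -
  let ?Z = "sum_topology (subtopology X) {K. compactin X K}"
  have "paracompact_space ?Z"
    by (intro paracompact_space_sum_topology compact_imp_paracompact_space
        compact_space_subtopology) simp
  moreover have "locally_compact_space ?Z"
    by (simp add: compact_space_subtopology locally_compact_space_sum_topology
        compact_imp_locally_compact_space)
  moreover have "quotient_map ?Z X snd"
    using assms by (simp add: k_space_as_quotient_explicit)
  ultimately show ?thesis
    unfolding is_quotient_of_def by blast
qed

theorem theorem1p1:
  shows
    "((\<forall>X :: 'a topology. sigma_compact_space X \<and> locally_compact_space X \<longrightarrow> k_omega_space X) \<and>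
      (\<forall>X :: 'a topology. locally_compact_space X \<longrightarrow> k_space X)) \<and>
     ((\<forall>(X :: 'a topology) (Y :: 'b topology).
         k_omega_space X \<and> is_quotient_of Y X \<longrightarrow> k_omega_space Y) \<and>
      (\<forall>(X :: 'a topology) (Y :: 'b topology).
         k_space X \<and> is_quotient_of Y X \<longrightarrow> k_space Y)) \<and>
     ((\<forall>X :: 'a topology. k_omega_space X \<longrightarrow>
         (\<exists>Z :: (nat \<times> 'a) topology.
            sigma_compact_space Z \<and> locally_compact_space Z \<and> is_quotient_of X Z)) \<and>
      (\<forall>X :: 'a topology. k_space X \<longrightarrow>
         (\<exists>Z :: ('a set \<times> 'a) topology.
            paracompact_space Z \<and> locally_compact_space Z \<and> is_quotient_of X Z)))"
proof (intro conjI allI impI; (elim conjE)?)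
  fix X :: "'a topology"
  assume "sigma_compact_space X" "locally_compact_space X"
  then show "k_omega_space X"
    by (rule sigma_compact_locally_compact_imp_k_omega_space)
next
  fix X :: "'a topology"
  assume "locally_compact_space X"
  then show "k_space X"
    by (rule locally_compact_imp_k_space)
next
  fix X :: "'a topology" and Y :: "'b topology"
  assume "k_omega_space X" "is_quotient_of Y X"
  then show "k_omega_space Y"
    unfolding is_quotient_of_def by (blast intro: k_omega_space_quotient_map_image)
next
  fix X :: "'a topology" and Y :: "'b topology"
  assume "k_space X" "is_quotient_of Y X"
  then show "k_space Y"
    unfolding is_quotient_of_def by (blast intro: k_space_quotient_map_image)
next
  fix X :: "'a topology"
  assume "k_omega_space X"
  then show "\<exists>Z :: (nat \<times> 'a) topology.
      sigma_compact_space Z \<and> locally_compact_space Z \<and> is_quotient_of X Z"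
    by (rule k_omega_space_imp_quotient)
next
  fix X :: "'a topology"
  assume "k_space X"
  then show "\<exists>Z :: ('a set \<times> 'a) topology.
      paracompact_space Z \<and> locally_compact_space Z \<and> is_quotient_of X Z"
    by (rule k_space_imp_quotient)
qed

end
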